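(* Let $M_1,\dots,M_N$ be measurements with finite nonempty outcome sets $\mathcal{K}_{M_1},\dots,\mathcal{K}_{M_N}$, let $\mathcal{J}$ be the family of jointly measurable subsets $S\subset\{1,\dots,N\}$, let $P$ be a given preparation, and for each $S\in\mathcal{J}$ let $p(k_S|M_S;P)$, $k_S=(k_s)_{s\in S}\in\mathcal{K}_{M_S}=\prod_{s\in S}\mathcal{K}_{M_s}$, be the probability distribution predicted by the operational theory for the joint measurement $M_S$ of $\{M_s : s\in S\}$ on the preparation $P$. Then the following are equivalent: 1. There exists a joint probability distribution $p(k_1,\dots,k_N|P)$ on $\prod_{i=1}^N\mathcal{K}_{M_i}$ such that for all $S\in\mathcal{J}$ and all $k_S\in\mathcal{K}_{M_S}$, $$p(k_S|M_S;P)=\sum_{k_i:\, i\notin S}p(k_1,\dots,k_N|P).$$ 2. There exists a measurement-noncontextual and outcome-deterministic (i.e. KS-noncontextual) ontological model for these measurements. 3. There exists a measurement-noncontextual and factorizable ontological model for these measurements.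
   Context: The family $\mathcal{J}$ of jointly measurable subsets contains every singleton $\{i\}$, with $M_{\{i\}}=M_i$. An ontological model for the measurements (relative to the preparation $P$) consists of a measurable space $\Lambda$ of ontic states $\lambda$, a probability measure on $\Lambda$ (written as a density $\mu(\lambda|P)\,d\lambda$), and, for each $S\in\mathcal{J}$, measurable response functions $\xi(k_S|M_S;\lambda)\in[0,1]$, $k_S\in\mathcal{K}_{M_S}$, with $\sum_{k_S}\xi(k_S|M_S;\lambda)=1$ for every $\lambda$, that reproduce the operational statistics: $$p(k_S|M_S;P)=\int_\Lambda d\lambda\,\mu(\lambda|P)\,\xi(k_S|M_S;\lambda)\qquad\text{for all }S\in\mathcal{J},\ k_S\in\mathcal{K}_{M_S}.$$ The model is measurement-noncontextual if the single-measurement response function $\xi(k_i|M_i;\lambda)$ is independent of the jointly measurable subset in which $M_i$ is measured: for every $S\in\mathcal{J}$, every $s\in S$ and every $\lambda$, the marginal of $\xi(k_S|M_S;\lambda)$ on $k_s$ equals $\xi(k_s|M_s;\lambda)$. The model is outcome-deterministic if every response function takes values in $\{0,1\}$, i.e. $\xi(k_S|M_S;\lambda)\in\{0,1\}$ for all $S\in\mathcal{J}$, $k_S$, $\lambda$. The model is factorizable if $\xi(k_S|M_S;\lambda)=\prod_{s\in S}\xi(k_s|M_s;\lambda)$ for all $S\in\mathcal{J}$, $k_S=(k_s)_{s\in S}\in\mathcal{K}_{M_S}$ and $\lambda\in\Lambda$. *)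

theory Defs
  imports "HOL-Probability.Probability"
begin

text \<open>
  Measurements are indexed by natural numbers; \<open>K i\<close> is the outcome set of measurement \<open>i\<close>,
  all outcome sets being embedded in a common type \<open>'k\<close>.  A joint outcome of the measurements
  in \<open>S\<close> is an element of \<open>PiE S K\<close>.  The single measurement \<open>i\<close> is identified with the joint
  measurement of \<open>{i}\<close>, so its outcome \<open>a \<in> K i\<close> appears as the function
  \<open>\<lambda>j\<in>{i}. a\<close> in \<open>PiE {i} K\<close>.  The distribution \<open>p S\<close> is the prediction for the joint
  measurement of \<open>S\<close> on a fixed preparation; only its values for \<open>S \<in> J\<close> are relevant.
\<close>

definition joint_distribution ::
  "nat \<Rightarrow> (nat \<Rightarrow> 'k set) \<Rightarrow> nat set set \<Rightarrow> (nat set \<Rightarrow> (nat \<Rightarrow> 'k) pmf) \<Rightarrow> (nat \<Rightarrow> 'k) pmf \<Rightarrow> bool"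
  where
  "joint_distribution N K J p q \<longleftrightarrow>
     set_pmf q \<subseteq> PiE {1..N} K \<and>
     (\<forall>S\<in>J. \<forall>k\<in>PiE S K.
        pmf (p S) k = (\<Sum>f | f \<in> PiE {1..N} K \<and> (\<forall>s\<in>S. f s = k s). pmf q f))"

text \<open>
  The ontic state space is \<open>space M\<close> with \<open>\<sigma>\<close>-algebra \<open>sets M\<close>, and \<open>M\<close> itself is the
  probability measure that the preparation induces on it; \<open>\<xi> S k x\<close> is the response function at the ontic
  state \<open>x\<close>.
\<close>

definition ontological_model ::
  "(nat \<Rightarrow> 'k set) \<Rightarrow> nat set set \<Rightarrow> (nat set \<Rightarrow> (nat \<Rightarrow> 'k) pmf) \<Rightarrow>
   'l measure \<Rightarrow> (nat set \<Rightarrow> (nat \<Rightarrow> 'k) \<Rightarrow> 'l \<Rightarrow> real) \<Rightarrow> bool"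
  where
  "ontological_model K J p M \<xi> \<longleftrightarrow>
     prob_space M \<and>
     (\<forall>S\<in>J.
        (\<forall>k\<in>PiE S K. \<xi> S k \<in> borel_measurable M \<and> (\<forall>x\<in>space M. \<xi> S k x \<in> {0..1})) \<and>
        (\<forall>x\<in>space M. (\<Sum>k\<in>PiE S K. \<xi> S k x) = 1) \<and>
        (\<forall>k\<in>PiE S K. pmf (p S) k = (\<integral>x. \<xi> S k x \<partial>M)))"

definition measurement_noncontextual ::
  "(nat \<Rightarrow> 'k set) \<Rightarrow> nat set set \<Rightarrow> 'l measure \<Rightarrow> (nat set \<Rightarrow> (nat \<Rightarrow> 'k) \<Rightarrow> 'l \<Rightarrow> real) \<Rightarrow> bool"
  where
  "measurement_noncontextual K J M \<xi> \<longleftrightarrow>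
     (\<forall>S\<in>J. \<forall>s\<in>S. \<forall>a\<in>K s. \<forall>x\<in>space M.
        (\<Sum>k | k \<in> PiE S K \<and> k s = a. \<xi> S k x) = \<xi> {s} (\<lambda>j\<in>{s}. a) x)"

definition outcome_deterministic ::
  "(nat \<Rightarrow> 'k set) \<Rightarrow> nat set set \<Rightarrow> 'l measure \<Rightarrow> (nat set \<Rightarrow> (nat \<Rightarrow> 'k) \<Rightarrow> 'l \<Rightarrow> real) \<Rightarrow> bool"
  where
  "outcome_deterministic K J M \<xi> \<longleftrightarrow>
     (\<forall>S\<in>J. \<forall>k\<in>PiE S K. \<forall>x\<in>space M. \<xi> S k x \<in> {0, 1})"

definition factorizable ::
  "(nat \<Rightarrow> 'k set) \<Rightarrow> nat set set \<Rightarrow> 'l measure \<Rightarrow> (nat set \<Rightarrow> (nat \<Rightarrow> 'k) \<Rightarrow> 'l \<Rightarrow> real) \<Rightarrow> bool"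
  where
  "factorizable K J M \<xi> \<longleftrightarrow>
     (\<forall>S\<in>J. \<forall>k\<in>PiE S K. \<forall>x\<in>space M.
        \<xi> S k x = (\<Prod>s\<in>S. \<xi> {s} (\<lambda>j\<in>{s}. k s) x))"

text \<open>
  HOL cannot quantify existentially over the type \<open>'l\<close> of ontic states.  The statement ``some
  ontological model (over any type whatsoever) exists if and only if \<open>A\<close>'' is therefore to be
  rendered by two claims: \<open>A\<close> is equivalent to the existence of a model over one concrete type,
  for which \<open>nat \<Rightarrow> 'k\<close> is taken, and a model over an arbitrary type \<open>'l\<close> implies \<open>A\<close>.
\<close>

end

theory Submission
  imports Defs
begin

text \<open>
  Given a joint distribution, take the global outcome assignments themselves as ontic states: each
  state answers every measurement with certainty. A noncontextual deterministic model is
  factorizable, because at each ontic state the unique joint outcome of \<open>S\<close> with response \<open>1\<close> is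
  determined by its marginals. Finally, in a factorizable model the single-measurement responses
  define at each ontic state a product distribution on all of \<open>PiE {1..N} K\<close>; averaging it over the
  ontic states gives the joint distribution.
\<close>

text \<open>Turns normalization over joint outcomes of the one-element set \<open>{i}\<close> into
  normalization over the plain outcome set \<open>K i\<close>.\<close>

lemma sum_PiE_singleton:
  "(\<Sum>k\<in>PiE {i} K. g k) = (\<Sum>a\<in>K i. g (\<lambda>j\<in>{i}. a))"
  for g :: "('i \<Rightarrow> 'a) \<Rightarrow> 'b::comm_monoid_add"
proof (rule sum.reindex_bij_witness[of _ "\<lambda>a. \<lambda>j\<in>{i}. a" "\<lambda>k. k i"])
  fix k assume "k \<in> PiE {i} K"
  then show "(\<lambda>j\<in>{i}. k i) = k"
    by (auto simp: PiE_def extensional_def restrict_def fun_eq_iff)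
  then show "g (\<lambda>j\<in>{i}. k i) = g k" by simp
qed (auto simp: PiE_iff)

text \<open>Marginalizing a product distribution. Fixing the coordinates in \<open>S\<close> leaves
  a smaller box, over which the sum of products is the product of the coordinate sums. Free
  coordinates contribute \<open>1\<close> by \<open>norm\<close>, fixed ones a single term.\<close>

lemma sum_prod_PiE_fixed:
  fixes h :: "'i \<Rightarrow> 'a \<Rightarrow> 'b::comm_semiring_1"
  assumes "finite I" "\<And>i. i \<in> I \<Longrightarrow> finite (K i)" "S \<subseteq> I" "k \<in> PiE S K"
    and norm: "\<And>i. i \<in> I \<Longrightarrow> (\<Sum>a\<in>K i. h i a) = 1"
  shows "(\<Sum>f | f \<in> PiE I K \<and> (\<forall>s\<in>S. f s = k s). \<Prod>i\<in>I. h i (f i)) = (\<Prod>s\<in>S. h s (k s))"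
proof -
  let ?K = "\<lambda>i. if i \<in> S then {k i} else K i"
  have "{f. f \<in> PiE I K \<and> (\<forall>s\<in>S. f s = k s)} = PiE I ?K"
  proof (rule set_eqI, unfold mem_Collect_eq)
    fix f
    have "f i \<in> K i \<and> (i \<in> S \<longrightarrow> f i = k i) \<longleftrightarrow> f i \<in> ?K i" if "i \<in> I" for i
      using PiE_mem[OF assms(4)] by auto
    then show "(f \<in> PiE I K \<and> (\<forall>s\<in>S. f s = k s)) = (f \<in> PiE I ?K)"
      unfolding PiE_iff using assms(3) by blast
  qed
  then have "(\<Sum>f | f \<in> PiE I K \<and> (\<forall>s\<in>S. f s = k s). \<Prod>i\<in>I. h i (f i))
      = (\<Prod>i\<in>I. \<Sum>a\<in>?K i. h i a)"
    using assms(1,2) by (simp add: prod_sum_PiE)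
  also have "\<dots> = (\<Prod>s\<in>S. \<Sum>a\<in>?K s. h s a)"
    using assms(1,3) norm by (intro prod.mono_neutral_right) auto
  finally show ?thesis by simp
qed

lemma joint_distribution_imp_deterministic_model:
  fixes p :: "nat set \<Rightarrow> (nat \<Rightarrow> 'k) pmf"
  assumes fin: "\<And>i. i \<in> {1..N} \<Longrightarrow> finite (K i)"
    and sub: "\<And>S. S \<in> J \<Longrightarrow> S \<subseteq> {1..N}"
    and q: "joint_distribution N K J p q"
  obtains M :: "(nat \<Rightarrow> 'k) measure" and \<xi> where
    "ontological_model K J p M \<xi>" "measurement_noncontextual K J M \<xi>"
    "outcome_deterministic K J M \<xi>"
proof -
  define X where "X = PiE {1..N} K"
  define M where "M = point_measure X (\<lambda>f. ennreal (pmf q f))"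
  \<comment> \<open>The response tests whether the assignment \<open>f\<close> restricts to
    \<open>k\<close>. The value that \<open>f\<close> gives to one measurement does not depend on
    \<open>S\<close>, which makes the model noncontextual.\<close>
  define \<xi> :: "nat set \<Rightarrow> (nat \<Rightarrow> 'k) \<Rightarrow> (nat \<Rightarrow> 'k) \<Rightarrow> real"
    where "\<xi> S k f = (if restrict f S = k then 1 else 0)" for S k f
  have finX: "finite X" using fin by (auto simp: X_def intro!: finite_PiE)
  have spM: "space M = X" and setsM: "sets M = Pow X"
    by (auto simp: M_def space_point_measure sets_point_measure)
  have finS: "finite (PiE S K)" if "S \<in> J" for S
    using fin sub[OF that] by (intro finite_PiE) (auto intro: finite_subset)
  have restr: "restrict f S \<in> PiE S K" if "f \<in> X" "S \<in> J" for f S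
    using that sub[of S] by (auto simp: X_def PiE_iff)
  have "prob_space M"
  proof
    have "emeasure M (space M) = (\<Sum>f\<in>X. ennreal (pmf q f))"
      unfolding spM using finX by (simp add: M_def emeasure_point_measure_finite)
    also have "\<dots> = 1"
      using q finX sum_pmf_eq_1[of X q] by (simp add: X_def joint_distribution_def)
    finally show "emeasure M (space M) = 1" .
  qed
  moreover have "\<xi> S k \<in> borel_measurable M" for S k
    by (simp add: M_def)
  moreover have "(\<Sum>k\<in>PiE S K. \<xi> S k f) = 1" if "f \<in> X" "S \<in> J" for f S
    using restr[OF that] finS[OF that(2)] by (simp add: \<xi>_def)
  moreover have "pmf (p S) k = (\<integral>f. \<xi> S k f \<partial>M)" if "S \<in> J" "k \<in> PiE S K" for S k
  proof -
    \<comment> \<open>Both sides are \<open>undefined\<close> off \<open>S\<close>, so only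
      agreement on \<open>S\<close> matters; this matches the constraint in
      \<open>joint_distribution\<close>.\<close>
    have eq: "restrict f S = k \<longleftrightarrow> (\<forall>s\<in>S. f s = k s)" for f
      using that(2) by (auto simp: fun_eq_iff PiE_iff extensional_def restrict_def)
    have "(\<integral>f. \<xi> S k f \<partial>M) = (\<Sum>f\<in>X. pmf q f * \<xi> S k f)"
      unfolding M_def by (subst lebesgue_integral_point_measure_finite) (use finX in auto)
    also have "\<dots> = (\<Sum>f | f \<in> X \<and> (\<forall>s\<in>S. f s = k s). pmf q f)"
      by (intro sum.mono_neutral_cong_right) (use finX in \<open>auto simp: \<xi>_def eq\<close>)
    finally show ?thesis using q that by (simp add: joint_distribution_def X_def)
  qed
  ultimately have "ontological_model K J p M \<xi>"
    by (simp add: ontological_model_def spM \<xi>_def)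
  moreover have "measurement_noncontextual K J M \<xi>"
    unfolding measurement_noncontextual_def spM
  proof (intro ballI)
    fix S s a f assume h: "S \<in> J" "s \<in> S" "a \<in> K s" "f \<in> X"
    \<comment> \<open>Only \<open>k = restrict f S\<close> contributes to the marginal, so both
      sides are the indicator of \<open>f s = a\<close>.\<close>
    have "restrict f {s} = (\<lambda>j\<in>{s}. a) \<longleftrightarrow> f s = a"
      by (auto simp: fun_eq_iff restrict_def)
    then show "(\<Sum>k | k \<in> PiE S K \<and> k s = a. \<xi> S k f) = \<xi> {s} (\<lambda>j\<in>{s}. a) f"
      using restr[OF h(4,1)] finS[OF h(1)] h(2) by (simp add: \<xi>_def)
  qed
  moreover have "outcome_deterministic K J M \<xi>"
    by (simp add: outcome_deterministic_def \<xi>_def)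
  ultimately show thesis by (rule that)
qed

lemma deterministic_imp_factorizable:
  assumes fin: "\<And>S. S \<in> J \<Longrightarrow> finite (PiE S K)"
    and finJ: "\<And>S. S \<in> J \<Longrightarrow> finite S"
    and single: "\<And>S s. S \<in> J \<Longrightarrow> s \<in> S \<Longrightarrow> {s} \<in> J"
    and om: "ontological_model K J p M \<xi>"
    and nc: "measurement_noncontextual K J M \<xi>"
    and od: "outcome_deterministic K J M \<xi>"
  shows "factorizable K J M \<xi>"
  unfolding factorizable_def
proof (intro ballI)
  fix S k x assume h: "S \<in> J" "k \<in> PiE S K" "x \<in> space M"
  have bound: "\<xi> T l x \<in> {0..1}" if "T \<in> J" "l \<in> PiE T K" for T l
    using om that h(3) by (simp add: ontological_model_def)
  have marg: "(\<Sum>l | l \<in> PiE S K \<and> l s = k s. \<xi> S l x) = \<xi> {s} (\<lambda>j\<in>{s}. k s) x" if "s \<in> S" for s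
    using nc h that by (auto simp: measurement_noncontextual_def PiE_iff)
  have norm: "(\<Sum>l\<in>PiE S K. \<xi> S l x) = 1"
    using om h by (simp add: ontological_model_def)
  have "\<xi> S k x = 0 \<or> \<xi> S k x = 1"
    using od h by (auto simp: outcome_deterministic_def)
  then show "\<xi> S k x = (\<Prod>s\<in>S. \<xi> {s} (\<lambda>j\<in>{s}. k s) x)"
  proof
    \<comment> \<open>\<open>\<xi> S k x\<close> is one of the nonnegative terms of each marginal,
      so every factor is at least \<open>1\<close>, hence equal to \<open>1\<close>.\<close>
    assume 1: "\<xi> S k x = 1"
    have "\<xi> {s} (\<lambda>j\<in>{s}. k s) x = 1" if s: "s \<in> S" for s
    proof (rule antisym)
      show "\<xi> {s} (\<lambda>j\<in>{s}. k s) x \<le> 1"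
        using bound[of "{s}" "\<lambda>j\<in>{s}. k s"] single[OF h(1) s] h(2) s by (auto simp: PiE_iff)
      have "\<xi> S k x \<le> (\<Sum>l | l \<in> PiE S K \<and> l s = k s. \<xi> S l x)"
        by (rule member_le_sum) (use h fin bound in auto)
      then show "1 \<le> \<xi> {s} (\<lambda>j\<in>{s}. k s) x" using marg[OF s] 1 by simp
    qed
    then show ?thesis using 1 by simp
  next
    \<comment> \<open>Some other outcome \<open>l\<close> has response \<open>1\<close> and
      disagrees with \<open>k\<close> at some \<open>s\<close>; the factor at that \<open>s\<close>
      will vanish and with it the product.\<close>
    assume 0: "\<xi> S k x = 0"
    obtain l where l: "l \<in> PiE S K" "\<xi> S l x \<noteq> 0"
      using norm by (metis sum.neutral zero_neq_one)
    then have l1: "\<xi> S l x = 1" using od h by (auto simp: outcome_deterministic_def)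
    have "l \<noteq> k" using l 0 by auto
    then obtain s where s: "s \<in> S" "l s \<noteq> k s" using l(1) h(2) by (meson PiE_ext)
    \<comment> \<open>Since \<open>l s \<noteq> k s\<close>, the outcome \<open>l\<close> is not
      counted in the marginal at \<open>k s\<close>. It already exhausts the total weight
      \<open>1\<close>, so nothing is left for that marginal.\<close>
    have "(\<Sum>m\<in>insert l {m. m \<in> PiE S K \<and> m s = k s}. \<xi> S m x) \<le> (\<Sum>m\<in>PiE S K. \<xi> S m x)"
      by (rule sum_mono2) (use h fin bound l in auto)
    moreover have "finite {m. m \<in> PiE S K \<and> m s = k s}" using fin[OF h(1)] by simp
    ultimately have "\<xi> {s} (\<lambda>j\<in>{s}. k s) x \<le> 0"
      using s norm l1 marg[OF s(1)] by simp
    moreover have "0 \<le> \<xi> {s} (\<lambda>j\<in>{s}. k s) x"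
      unfolding marg[OF s(1), symmetric] by (rule sum_nonneg) (use bound h in auto)
    ultimately show ?thesis using 0 s finJ[OF h(1)] by simp force
  qed
qed

lemma factorizable_imp_joint_distribution:
  assumes fin: "\<And>i. i \<in> {1..N} \<Longrightarrow> finite (K i)"
    and sub: "\<And>S. S \<in> J \<Longrightarrow> S \<subseteq> {1..N}"
    and single: "\<And>i. i \<in> {1..N} \<Longrightarrow> {i} \<in> J"
    and om: "ontological_model K J p M \<xi>"
    and fa: "factorizable K J M \<xi>"
  shows "\<exists>q. joint_distribution N K J p q"
proof -
  interpret prob_space M using om by (simp add: ontological_model_def)
  define X where "X = PiE {1..N} K"
  define h where "h x i a = \<xi> {i} (\<lambda>j\<in>{i}. a) x" for x i a
  define g where "g f = (\<integral>x. (\<Prod>i\<in>{1..N}. h x i (f i)) \<partial>M)" for f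
  have finX: "finite X" using fin by (auto simp: X_def intro!: finite_PiE)
  have h_meas [measurable]: "(\<lambda>x. h x i a) \<in> borel_measurable M"
    if "i \<in> {1..N}" "a \<in> K i" for i a
    using om single[OF that(1)] that(2) by (auto simp: ontological_model_def h_def[abs_def])
  have h_bound: "0 \<le> h x i a \<and> h x i a \<le> 1"
    if "i \<in> {1..N}" "a \<in> K i" "x \<in> space M" for x i a
    using om single[OF that(1)] that(2,3) by (auto simp: ontological_model_def h_def)
  have h_norm: "(\<Sum>a\<in>K i. h x i a) = 1" if "i \<in> {1..N}" "x \<in> space M" for x i
    using om single[OF that(1)] that(2) sum_PiE_singleton[of "\<lambda>k. \<xi> {i} k x" i K]
    by (simp add: ontological_model_def h_def)
  \<comment> \<open>Integrability is what lets the finite sum in \<open>marginal\<close> move inside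
    the integral.\<close>
  have int: "integrable M (\<lambda>x. \<Prod>i\<in>{1..N}. h x i (f i))" if "f \<in> X" for f
  proof (rule integrable_const_bound[where B = 1])
    have "\<bar>\<Prod>i\<in>{1..N}. h x i (f i)\<bar> \<le> 1" if "x \<in> space M" for x
      unfolding abs_prod
      by (rule prod_le_1) (use that \<open>f \<in> X\<close> h_bound in \<open>auto simp: X_def PiE_iff\<close>)
    then show "AE x in M. norm (\<Prod>i\<in>{1..N}. h x i (f i)) \<le> 1" by simp
    show "(\<lambda>x. \<Prod>i\<in>{1..N}. h x i (f i)) \<in> borel_measurable M"
      by (rule borel_measurable_prod) (use that h_meas in \<open>auto simp: X_def PiE_iff\<close>)
  qed
  have g_nonneg: "0 \<le> g f" if "f \<in> X" for f
    unfolding g_def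
    by (intro integral_nonneg_AE AE_I2 prod_nonneg)
      (use that h_bound in \<open>auto simp: X_def PiE_iff\<close>)
  have marginal: "(\<Sum>f | f \<in> X \<and> (\<forall>s\<in>S. f s = k s). g f) = (\<integral>x. (\<Prod>s\<in>S. h x s (k s)) \<partial>M)"
    if "S \<subseteq> {1..N}" "k \<in> PiE S K" for S k
  proof -
    have "(\<Sum>f | f \<in> X \<and> (\<forall>s\<in>S. f s = k s). g f)
        = (\<integral>x. (\<Sum>f | f \<in> X \<and> (\<forall>s\<in>S. f s = k s). \<Prod>i\<in>{1..N}. h x i (f i)) \<partial>M)"
      unfolding g_def by (rule Bochner_Integration.integral_sum[symmetric]) (use int in auto)
    also have "\<dots> = (\<integral>x. (\<Prod>s\<in>S. h x s (k s)) \<partial>M)"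
      unfolding X_def
      by (intro Bochner_Integration.integral_cong refl sum_prod_PiE_fixed)
        (use that fin h_norm in auto)
    finally show ?thesis .
  qed
  have g_sum: "(\<Sum>f\<in>X. g f) = 1"
    \<comment> \<open>With \<open>S = {}\<close> there is no constraint on \<open>f\<close>, and the
      empty product integrates to \<open>1\<close> over a probability space.
      \<open>\<lambda>_. undefined\<close> is the sole element of \<open>PiE {} K\<close>.\<close>
    using marginal[of "{}" "\<lambda>_. undefined"] by (simp add: prob_space)
  \<comment> \<open>The bounds on \<open>h\<close> control \<open>g\<close> only on
    \<open>X\<close>, whereas a pmf lives on the whole function type; hence the value
    \<open>0\<close> elsewhere.\<close>
  define q where "q = embed_pmf (\<lambda>f. if f \<in> X then g f else 0)"
  have pmf_q: "pmf q f = (if f \<in> X then g f else 0)" for f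
    unfolding q_def
  proof (rule pmf_embed_pmf)
    have "(\<integral>\<^sup>+f. ennreal (if f \<in> X then g f else 0) \<partial>count_space UNIV)
        = (\<Sum>f\<in>X. ennreal (if f \<in> X then g f else 0))"
      by (rule nn_integral_count_space'[OF finX]) auto
    also have "\<dots> = ennreal (\<Sum>f\<in>X. g f)"
      using g_nonneg by simp
    finally show "(\<integral>\<^sup>+f. ennreal (if f \<in> X then g f else 0) \<partial>count_space UNIV) = 1"
      using g_sum by simp
  qed (use g_nonneg in auto)
  have "set_pmf q \<subseteq> X"
    by (auto simp: set_pmf_iff pmf_q split: if_splits)
  moreover have "pmf (p S) k = (\<Sum>f | f \<in> X \<and> (\<forall>s\<in>S. f s = k s). pmf q f)"
    if "S \<in> J" "k \<in> PiE S K" for S k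
  proof -
    have "pmf (p S) k = (\<integral>x. \<xi> S k x \<partial>M)"
      using om that by (simp add: ontological_model_def)
    also have "\<dots> = (\<integral>x. (\<Prod>s\<in>S. h x s (k s)) \<partial>M)"
      using fa that
      by (intro Bochner_Integration.integral_cong) (auto simp: factorizable_def h_def)
    also have "\<dots> = (\<Sum>f | f \<in> X \<and> (\<forall>s\<in>S. f s = k s). g f)"
      using marginal[OF sub[OF that(1)] that(2)] by simp
    also have "\<dots> = (\<Sum>f | f \<in> X \<and> (\<forall>s\<in>S. f s = k s). pmf q f)"
      by (rule sum.cong) (auto simp: pmf_q)
    finally show ?thesis .
  qed
  ultimately have "joint_distribution N K J p q"
    by (simp add: joint_distribution_def X_def)
  then show ?thesis ..
qed

theorem theorem1:
  fixes N :: nat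
    and K :: "nat \<Rightarrow> 'k set"
    and J :: "nat set set"
    and p :: "nat set \<Rightarrow> (nat \<Rightarrow> 'k) pmf"
  assumes "\<And>i. i \<in> {1..N} \<Longrightarrow> finite (K i)"
    and "\<And>i. i \<in> {1..N} \<Longrightarrow> K i \<noteq> {}"
    and "\<And>S. S \<in> J \<Longrightarrow> S \<subseteq> {1..N}"
    and "\<And>i. i \<in> {1..N} \<Longrightarrow> {i} \<in> J"
    and "\<And>S. S \<in> J \<Longrightarrow> set_pmf (p S) \<subseteq> PiE S K"
  shows
    "((\<exists>q. joint_distribution N K J p q) \<longleftrightarrow>
        (\<exists>(M :: (nat \<Rightarrow> 'k) measure) \<xi>. ontological_model K J p M \<xi> \<and>
            measurement_noncontextual K J M \<xi> \<and> outcome_deterministic K J M \<xi>)) \<and>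
     ((\<exists>q. joint_distribution N K J p q) \<longleftrightarrow>
        (\<exists>(M :: (nat \<Rightarrow> 'k) measure) \<xi>. ontological_model K J p M \<xi> \<and>
            measurement_noncontextual K J M \<xi> \<and> factorizable K J M \<xi>)) \<and>
     ((\<exists>(M :: 'l measure) \<xi>. ontological_model K J p M \<xi> \<and>
            measurement_noncontextual K J M \<xi> \<and> outcome_deterministic K J M \<xi>) \<longrightarrow>
        (\<exists>q. joint_distribution N K J p q)) \<and>
     ((\<exists>(M :: 'l measure) \<xi>. ontological_model K J p M \<xi> \<and>
            measurement_noncontextual K J M \<xi> \<and> factorizable K J M \<xi>) \<longrightarrow>
        (\<exists>q. joint_distribution N K J p q))"
proof -
  have finJ: "finite S" "finite (PiE S K)" if "S \<in> J" for S
    using assms(1) assms(3)[OF that] by (auto intro!: finite_PiE intro: finite_subset)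
  have single: "{s} \<in> J" if "S \<in> J" "s \<in> S" for S s
    using assms(3)[OF that(1)] that(2) assms(4) by blast
  have model: "\<exists>(M :: (nat \<Rightarrow> 'k) measure) \<xi>. ontological_model K J p M \<xi> \<and>
      measurement_noncontextual K J M \<xi> \<and> outcome_deterministic K J M \<xi>"
    if ex: "\<exists>q. joint_distribution N K J p q"
  proof -
    obtain q where "joint_distribution N K J p q"
      using ex by blast
    from joint_distribution_imp_deterministic_model[OF assms(1,3) this] show ?thesis
      by blast
  qed
  \<comment> \<open>The type \<open>'x\<close> is left general here and in \<open>joint\<close>, so
    that both facts serve models over \<open>nat \<Rightarrow> 'k\<close> as well as over
    \<open>'l\<close>.\<close>
  have factor: "factorizable K J M \<xi>"
    if "ontological_model K J p M \<xi>" "measurement_noncontextual K J M \<xi>"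
      "outcome_deterministic K J M \<xi>" for M :: "'x measure" and \<xi>
    using deterministic_imp_factorizable[OF finJ(2,1) single that] .
  have joint: "\<exists>q. joint_distribution N K J p q"
    if "ontological_model K J p M \<xi>" "factorizable K J M \<xi>" for M :: "'x measure" and \<xi>
    using factorizable_imp_joint_distribution[OF assms(1,3,4) that] .
  show ?thesis
    \<comment> \<open>Where the premise is a joint distribution, \<open>model\<close> replaces it by
      a deterministic model, which \<open>factor\<close> shows to be factorizable too. Where it is a
      model, \<open>joint\<close> finishes, after \<open>factor\<close> in the deterministic
      case.\<close>
    by (intro conjI iffI impI; (drule model)?; (elim exE conjE)?) (blast intro: factor joint)+
qed

end
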